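(* Fix an integer $r\ge 4$ and choose a real $$0<\delta<\frac1{2(r-1)}.$$ Then there is a constant $c=c(r,\delta)>0$ such that, for all sufficiently large $n$, the complete graph $K_n$ contains a subgraph $Y$ and a set $F\subseteq E(Y)$ such that $$\chi_{\mathrm f}(Y)\ge c\,\frac{n^\delta}{\log n},\qquad \Delta\bigl((V(Y),F)\bigr)\le 1,\qquad \operatorname{girth}(Y-F)\ge r.$$ Consequently $$h_r^{\mathrm f}(K_n)\ge c\,\frac{n^\delta}{\log n}.$$
   Context: All graphs are finite and simple; subgraphs need not be induced. $\chi_{\mathrm f}$ is the fractional chromatic number; $\Delta$ is the maximum degree; $(V(Y),F)$ is the graph on $V(Y)$ with edge set $F$; $Y-F$ is $Y$ with the edges of $F$ deleted. The girth of a forest is $\infty$; $\log$ is natural. $h_r^{\mathrm f}(G)=\max\{\chi_{\mathrm f}(H):H\subseteq G,\ \operatorname{girth}(H)\ge r\}$. The constant $c$ in the final bound may be taken smaller than the one in the first display, still depending only on $r,\delta$. *)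

theory Defs
  imports Complex_Main "HOL-Library.Extended_Nat" "HOL-Library.Ramsey"
begin

text \<open>A graph is a pair of a vertex set and a set of edges, an edge being a two-element
  set of vertices.\<close>

type_synonym 'a ugraph = "'a set \<times> 'a set set"

abbreviation vertices :: "'a ugraph \<Rightarrow> 'a set" where
  "vertices \<equiv> fst"

abbreviation edges :: "'a ugraph \<Rightarrow> 'a set set" where
  "edges \<equiv> snd"

definition fin_simple_graph :: "'a ugraph \<Rightarrow> bool" where
  "fin_simple_graph G \<longleftrightarrow> finite (vertices G) \<and> edges G \<subseteq> nsets (vertices G) 2"

definition is_subgraph :: "'a ugraph \<Rightarrow> 'a ugraph \<Rightarrow> bool" where
  "is_subgraph H G \<longleftrightarrow>
     fin_simple_graph H \<and> vertices H \<subseteq> vertices G \<and> edges H \<subseteq> edges G"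

definition complete_graph :: "nat \<Rightarrow> nat ugraph" where
  "complete_graph n = ({..<n}, nsets {..<n} 2)"

definition delete_edges :: "'a ugraph \<Rightarrow> 'a set set \<Rightarrow> 'a ugraph" where
  "delete_edges G F = (vertices G, edges G - F)"

definition degree :: "'a ugraph \<Rightarrow> 'a \<Rightarrow> nat" where
  "degree G v = card {e \<in> edges G. v \<in> e}"

text \<open>The inserted 0 only matters for the graph without vertices.\<close>

definition max_degree :: "'a ugraph \<Rightarrow> nat" where
  "max_degree G = Max (insert 0 (degree G ` vertices G))"

definition is_cycle :: "'a ugraph \<Rightarrow> 'a list \<Rightarrow> bool" where
  "is_cycle G c \<longleftrightarrow> 3 \<le> length c \<and> distinct c \<and> set c \<subseteq> vertices G \<and>
     (\<forall>i<length c. {c ! i, c ! (Suc i mod length c)} \<in> edges G)"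

text \<open>The infimum of the empty set is \<open>\<infinity>\<close>, which is the girth of a forest.\<close>

definition girth :: "'a ugraph \<Rightarrow> enat" where
  "girth G = (INF c\<in>{c. is_cycle G c}. enat (length c))"

definition independent_sets :: "'a ugraph \<Rightarrow> 'a set set" where
  "independent_sets G = {S. S \<subseteq> vertices G \<and> (\<forall>e\<in>edges G. \<not> e \<subseteq> S)}"

definition fractional_colouring :: "'a ugraph \<Rightarrow> ('a set \<Rightarrow> real) \<Rightarrow> bool" where
  "fractional_colouring G w \<longleftrightarrow>
     (\<forall>S\<in>independent_sets G. 0 \<le> w S) \<and>
     (\<forall>v\<in>vertices G. 1 \<le> (\<Sum>S\<in>{S \<in> independent_sets G. v \<in> S}. w S))"

definition fractional_chromatic_number :: "'a ugraph \<Rightarrow> real" where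
  "fractional_chromatic_number G =
     Inf {(\<Sum>S\<in>independent_sets G. w S) |w. fractional_colouring G w}"

definition h_frac :: "nat \<Rightarrow> 'a ugraph \<Rightarrow> real" where
  "h_frac r G =
     Max {fractional_chromatic_number H |H. is_subgraph H G \<and> enat r \<le> girth H}"

text \<open>The real-valued \<open>Inf\<close> and \<open>Max\<close> above are not junk values: the sets are nonempty, and
  bounded below or finite, respectively.\<close>

lemma finite_independent_sets:
  assumes "fin_simple_graph G"
  shows "finite (independent_sets G)"
  using assms finite_subset[of "independent_sets G" "Pow (vertices G)"]
  by (auto simp: fin_simple_graph_def independent_sets_def)

lemma fractional_colouring_singletons:
  assumes "fin_simple_graph G"
  shows "fractional_colouring G (\<lambda>S. if card S = 1 then 1 else 0)"
  unfolding fractional_colouring_def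
proof (intro conjI ballI)
  fix v assume v: "v \<in> vertices G"
  let ?A = "{S \<in> independent_sets G. v \<in> S}"
  have "{v} \<in> ?A"
  proof -
    have "\<not> e \<subseteq> {v}" if "e \<in> edges G" for e
    proof
      assume "e \<subseteq> {v}"
      moreover have "card e = 2"
        using assms that by (auto simp: fin_simple_graph_def nsets_def)
      ultimately show False
        using card_mono[of "{v}" e] by simp
    qed
    then show ?thesis using v by (auto simp: independent_sets_def)
  qed
  moreover have "finite ?A" using finite_independent_sets[OF assms] by simp
  ultimately show "1 \<le> (\<Sum>S\<in>?A. if card S = 1 then 1 else (0::real))"
    using member_le_sum[of "{v}" ?A "\<lambda>S. if card S = 1 then 1 else (0::real)"] by auto
qed auto

lemma fractional_colouring_weights_bdd_below:
  "bdd_below {(\<Sum>S\<in>independent_sets G. w S) |w. fractional_colouring G w}"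
  by (rule bdd_belowI[of _ 0]) (auto simp: fractional_colouring_def intro: sum_nonneg)

lemma finite_subgraphs:
  assumes "fin_simple_graph G"
  shows "finite {H. is_subgraph H G}"
proof (rule finite_subset)
  show "{H. is_subgraph H G} \<subseteq> Pow (vertices G) \<times> Pow (edges G)"
    by (auto simp: is_subgraph_def)
  have "finite (edges G)"
    using assms finite_imp_finite_nsets[of "vertices G" 2] finite_subset
    by (auto simp: fin_simple_graph_def)
  then show "finite (Pow (vertices G) \<times> Pow (edges G))"
    using assms by (auto simp: fin_simple_graph_def)
qed

lemma is_subgraph_null_girth: "is_subgraph ({}, {}) G \<and> enat r \<le> girth ({}, {})"
  unfolding girth_def
  by (intro conjI INF_greatest) (auto simp: is_subgraph_def fin_simple_graph_def is_cycle_def)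

end

theory Submission
  imports Defs "HOL-Real_Asymp.Real_Asymp"
begin

text \<open>Already \<open>F = {}\<close> works, by the deletion method of Erdos. In a random graph on \<open>n\<close> vertices with
  edge probability \<open>p = n powr (2 * \<delta> - 1)\<close>, the expected number of cycles of length less than \<open>r\<close>
  is \<open>O(n powr (2 * \<delta> * (r - 1)))\<close>, which is \<open>o(n)\<close>. A union bound over all \<open>2 ^ n\<close> vertex sets shows
  that, with high probability, no set of at least \<open>4 * n powr (1 - \<delta>)\<close> vertices is independent. Deleting a vertex of each
  short cycle leaves at least \<open>n / 2\<close> vertices, and the fractional chromatic number is at least the
  number of vertices divided by the independence number.\<close>

section \<open>Edge sets of cycles\<close>

text \<open>Collecting the edges in a set turns the event that \<open>c\<close> is a cycle of the
  random graph into an inclusion.\<close>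

definition cycle_edges :: "'a list \<Rightarrow> 'a set set" where
  "cycle_edges c = (\<lambda>i. {c ! i, c ! (Suc i mod length c)}) ` {..<length c}"

text \<open>Makes \<open>p ^ length c\<close> the probability that all edges of \<open>c\<close> are
  present. With only two vertices both indices would give the same edge.\<close>

lemma card_cycle_edges:
  assumes "distinct c" and "3 \<le> length c"
  shows "card (cycle_edges c) = length c"
proof -
  have "inj_on (\<lambda>i. {c ! i, c ! (Suc i mod length c)}) {..<length c}"
  proof (rule inj_onI)
    fix i j
    assume i: "i \<in> {..<length c}" and j: "j \<in> {..<length c}"
      and eq: "{c ! i, c ! (Suc i mod length c)} = {c ! j, c ! (Suc j mod length c)}"
    have m: "Suc k mod length c < length c" for k
      using assms(2) by (intro mod_less_divisor) auto
    \<comment> \<open>Two equal pairs match either directly or crosswise; a crosswise match means i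
      = i + 2 modulo the length, impossible from length 3 on.\<close>
    have "i = j \<or> (i = Suc j mod length c \<and> j = Suc i mod length c)"
      using eq i j m by (auto simp: doubleton_eq_iff nth_eq_iff_index_eq[OF assms(1)])
    then show "i = j"
      using i j assms(2) by (auto simp: mod_Suc split: if_splits)
  qed
  then show ?thesis
    by (simp add: cycle_edges_def card_image)
qed

lemma cycle_edges_subset:
  assumes "distinct c" and "3 \<le> length c" and "set c \<subseteq> V"
  shows "cycle_edges c \<subseteq> nsets V 2"
proof
  fix e assume "e \<in> cycle_edges c"
  then obtain i where i: "i < length c" and e: "e = {c ! i, c ! (Suc i mod length c)}"
    by (auto simp: cycle_edges_def)
  have m: "Suc i mod length c < length c"
    using assms(2) by (intro mod_less_divisor) auto
  have "i \<noteq> Suc i mod length c"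
    using i assms(2) by (auto simp: mod_Suc)
  then have "c ! i \<noteq> c ! (Suc i mod length c)"
    using i m nth_eq_iff_index_eq[OF assms(1)] by simp
  moreover have "c ! i \<in> V" "c ! (Suc i mod length c) \<in> V"
    using assms(3) i m by auto
  ultimately show "e \<in> nsets V 2"
    by (simp add: e nsets_def)
qed

lemma is_cycle_iff_cycle_edges:
  "is_cycle G c \<longleftrightarrow>
     3 \<le> length c \<and> distinct c \<and> set c \<subseteq> vertices G \<and> cycle_edges c \<subseteq> edges G"
  by (auto simp: is_cycle_def cycle_edges_def)

section \<open>Random subsets of a finite set\<close>

text \<open>Expand the product over \<open>A\<close> of \<open>p + q\<close>, with \<open>q\<close>
  replaced by 0 on \<open>B\<close>: the terms are indexed by the set \<open>E\<close> of factors
  contributing \<open>p\<close>, and the zeros kill every \<open>E\<close> that misses part of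
  \<open>B\<close>. For \<open>q = 1 - p\<close> this is the probability of containing
  \<open>B\<close>.\<close>

lemma sum_weight_superset:
  fixes p q :: real
  assumes "finite A" and "B \<subseteq> A"
  shows "(\<Sum>E\<in>Pow A. p ^ card E * q ^ card (A - E) * of_bool (B \<subseteq> E))
    = p ^ card B * (p + q) ^ card (A - B)"
proof -
  have "p ^ card B * (p + q) ^ card (A - B) = (\<Prod>e\<in>A. p + (if e \<in> B then 0 else q))"
  proof -
    have "(\<Prod>e\<in>A. p + (if e \<in> B then 0 else q))
      = (\<Prod>e\<in>A - B. p + (if e \<in> B then 0 else q)) * (\<Prod>e\<in>B. p + (if e \<in> B then 0 else q))"
      by (rule prod.subset_diff[OF assms(2,1)])
    then show ?thesis by simp
  qed
  also have "\<dots> = (\<Sum>E\<in>Pow A. (\<Prod>e\<in>E. p) * (\<Prod>e\<in>A - E. if e \<in> B then 0 else q))"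
    by (rule prod_add[OF assms(1)])
  also have "\<dots> = (\<Sum>E\<in>Pow A. p ^ card E * q ^ card (A - E) * of_bool (B \<subseteq> E))"
  proof (rule sum.cong[OF refl])
    fix E assume "E \<in> Pow A"
    have "(\<Prod>e\<in>A - E. if e \<in> B then 0 else q) = q ^ card (A - E) * of_bool (B \<subseteq> E)"
    proof (cases "B \<subseteq> E")
      case True
      then have "(\<Prod>e\<in>A - E. if e \<in> B then 0 else q) = (\<Prod>e\<in>A - E. q)"
        by (intro prod.cong) auto
      with True show ?thesis by simp
    next
      case False
      with assms have "\<exists>e\<in>A - E. e \<in> B" by auto
      with False assms(1) show ?thesis by (auto intro!: prod_zero)
    qed
    then show "(\<Prod>e\<in>E. p) * (\<Prod>e\<in>A - E. if e \<in> B then 0 else q)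
      = p ^ card E * q ^ card (A - E) * of_bool (B \<subseteq> E)"
      by simp
  qed
  finally show ?thesis by simp
qed

text \<open>Complementation in \<open>A\<close> exchanges \<open>p\<close> and \<open>q\<close> and
  turns disjointness from \<open>B\<close> into containment of \<open>B\<close>.\<close>

lemma sum_weight_disjoint:
  fixes p q :: real
  assumes "finite A" and "B \<subseteq> A"
  shows "(\<Sum>E\<in>Pow A. p ^ card E * q ^ card (A - E) * of_bool (B \<inter> E = {}))
    = q ^ card B * (p + q) ^ card (A - B)"
proof -
  have "(\<Sum>E\<in>Pow A. p ^ card E * q ^ card (A - E) * of_bool (B \<inter> E = {}))
    = (\<Sum>E\<in>Pow A. q ^ card E * p ^ card (A - E) * of_bool (B \<subseteq> E))"
    by (rule sum.reindex_bij_witness[of _ "\<lambda>E. A - E" "\<lambda>E. A - E"])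
      (use assms(2) in \<open>auto simp: double_diff\<close>)
  then show ?thesis
    using sum_weight_superset[OF assms, of q p] by (simp add: add.commute)
qed

text \<open>First-moment method for a random subset of \<open>A\<close> that contains each element independently
  with probability \<open>p\<close>; the factor \<open>t\<close> merges the two bad events into one expectation.\<close>

lemma exists_random_subset:
  fixes p t :: real
  assumes "finite A" and "finite C" and "finite I"
    and D: "\<And>c. c \<in> C \<Longrightarrow> D c \<subseteq> A" and T: "\<And>S. S \<in> I \<Longrightarrow> T S \<subseteq> A"
    and p: "0 \<le> p" "p \<le> 1" and t: "0 \<le> t"
    and bound: "(\<Sum>c\<in>C. p ^ card (D c)) + t * (\<Sum>S\<in>I. (1 - p) ^ card (T S)) < t"
  obtains E where "E \<subseteq> A" and "real (card {c \<in> C. D c \<subseteq> E}) < t"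
    and "\<And>S. S \<in> I \<Longrightarrow> T S \<inter> E \<noteq> {}"
proof -
  define W where "W E = p ^ card E * (1 - p) ^ card (A - E)" for E
  define X where "X E = (\<Sum>c\<in>C. of_bool (D c \<subseteq> E)) + t * (\<Sum>S\<in>I. of_bool (T S \<inter> E = {}))" for E
  have W_nonneg: "0 \<le> W E" for E
    using p by (simp add: W_def)
  have W_sum: "(\<Sum>E\<in>Pow A. W E) = 1"
    using sum_weight_superset[OF assms(1), of "{}" p "1 - p"] by (simp add: W_def)
  have "(\<Sum>E\<in>Pow A. W E * X E)
    = (\<Sum>E\<in>Pow A. \<Sum>c\<in>C. W E * of_bool (D c \<subseteq> E))
      + t * (\<Sum>E\<in>Pow A. \<Sum>S\<in>I. W E * of_bool (T S \<inter> E = {}))"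
    by (simp add: X_def distrib_left sum.distrib sum_distrib_left mult_ac)
  also have "\<dots> = (\<Sum>c\<in>C. \<Sum>E\<in>Pow A. W E * of_bool (D c \<subseteq> E))
      + t * (\<Sum>S\<in>I. \<Sum>E\<in>Pow A. W E * of_bool (T S \<inter> E = {}))"
    by (simp only: sum.swap[of _ "Pow A"])
  also have "\<dots> = (\<Sum>c\<in>C. p ^ card (D c)) + t * (\<Sum>S\<in>I. (1 - p) ^ card (T S))"
    using sum_weight_superset[OF assms(1) D, of _ p "1 - p"]
      sum_weight_disjoint[OF assms(1) T, of _ p "1 - p"]
    by (simp add: W_def)
  also have "\<dots> < (\<Sum>E\<in>Pow A. W E * t)"
    using bound by (simp add: W_sum flip: sum_distrib_right)
  \<comment> \<open>The weights \<open>W\<close> are nonnegative, so if \<open>X E\<close> were at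
    least \<open>t\<close> for every \<open>E\<close>, so would be the average.\<close>
  finally have "\<exists>E\<in>Pow A. X E < t"
    using W_nonneg by (meson linorder_not_le mult_left_mono sum_mono)
  then obtain E where E: "E \<subseteq> A" "X E < t" by auto
  have card_C: "(\<Sum>c\<in>C. of_bool (D c \<subseteq> E)) = real (card {c \<in> C. D c \<subseteq> E})"
    using assms(2) by (simp add: sum.If_cases of_bool_def Int_def)
  have "T S \<inter> E \<noteq> {}" if "S \<in> I" for S
  proof
    assume "T S \<inter> E = {}"
    \<comment> \<open>A single set \<open>T S\<close> missed by \<open>E\<close> already contributes
      \<open>t\<close> to \<open>X E\<close>.\<close>
    then have "1 \<le> (\<Sum>S\<in>I. of_bool (T S \<inter> E = {}) :: real)"
      using member_le_sum[OF that, of "\<lambda>S. of_bool (T S \<inter> E = {}) :: real"] assms(3) by simp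
    then have "t * 1 \<le> t * (\<Sum>S\<in>I. of_bool (T S \<inter> E = {}))"
      using t by (intro mult_left_mono) auto
    then show False
      using E(2) card_C by (simp add: X_def)
  qed
  moreover have "0 \<le> t * (\<Sum>S\<in>I. of_bool (T S \<inter> E = {}))"
    using t by (intro mult_nonneg_nonneg sum_nonneg) auto
  then have "real (card {c \<in> C. D c \<subseteq> E}) < t"
    using E(2) card_C by (simp add: X_def)
  ultimately show ?thesis using that E(1) by blast
qed

section \<open>Fractional chromatic number and independence number\<close>

text \<open>Double counting: the vertices together receive weight at least their number, while an
  independent set \<open>S\<close> supplies only \<open>card S * w S\<close>, at most
  \<open>s * w S\<close>.\<close>

lemma fractional_chromatic_number_ge:
  fixes s :: real
  assumes G: "fin_simple_graph G" and s: "0 < s"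
    and indep: "\<And>S. S \<in> independent_sets G \<Longrightarrow> real (card S) \<le> s"
  shows "real (card (vertices G)) / s \<le> fractional_chromatic_number G"
  unfolding fractional_chromatic_number_def
proof (rule cInf_greatest)
  show "{(\<Sum>S\<in>independent_sets G. w S) |w. fractional_colouring G w} \<noteq> {}"
    using fractional_colouring_singletons[OF G] by blast
next
  fix x assume "x \<in> {(\<Sum>S\<in>independent_sets G. w S) |w. fractional_colouring G w}"
  then obtain w where x: "x = (\<Sum>S\<in>independent_sets G. w S)" and w: "fractional_colouring G w"
    by blast
  let ?I = "independent_sets G"
  have fin: "finite ?I" "finite (vertices G)"
    using G finite_independent_sets[OF G] by (auto simp: fin_simple_graph_def)
  have "real (card (vertices G)) \<le> (\<Sum>v\<in>vertices G. \<Sum>S\<in>{S \<in> ?I. v \<in> S}. w S)"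
    using w sum_mono[of "vertices G" "\<lambda>_. 1::real"] by (simp add: fractional_colouring_def)
  also have "\<dots> = (\<Sum>S\<in>?I. \<Sum>v\<in>{v \<in> vertices G. v \<in> S}. w S)"
    by (rule sum.swap_restrict[OF fin(2,1)])
  also have "\<dots> = (\<Sum>S\<in>?I. real (card S) * w S)"
  proof (rule sum.cong[OF refl])
    fix S assume "S \<in> ?I"
    then have "{v \<in> vertices G. v \<in> S} = S" by (auto simp: independent_sets_def)
    then show "(\<Sum>v\<in>{v \<in> vertices G. v \<in> S}. w S) = real (card S) * w S" by simp
  qed
  also have "\<dots> \<le> (\<Sum>S\<in>?I. s * w S)"
    using w indep by (intro sum_mono mult_right_mono) (auto simp: fractional_colouring_def)
  finally show "real (card (vertices G)) / s \<le> x"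
    using s by (simp add: x sum_distrib_left field_simps)
qed

section \<open>The deletion method for fixed n\<close>

text \<open>In \<open>bound\<close>, the k-th term covers the \<open>n ^ k\<close> vertex lists of
  length k, each a cycle with probability at most \<open>p ^ k\<close>; \<open>2 ^ n\<close> bounds
  the number of vertex sets with at least \<open>s\<close> elements, each spanning at least
  \<open>s choose 2\<close> pairs. The threshold \<open>n / 2\<close> is the number of vertices that
  deletion may cost.\<close>

lemma exists_high_girth_graph:
  fixes p :: real and n r s :: nat
  assumes p: "0 \<le> p" "p \<le> 1" and s: "0 < s"
    and bound: "(\<Sum>k=3..<r. (real n * p) ^ k) + real n / 2 * (2 ^ n * (1 - p) ^ (s choose 2))
      < real n / 2"
  obtains Y where "is_subgraph Y (complete_graph n)" and "enat r \<le> girth Y"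
    and "real n / 2 / real s \<le> fractional_chromatic_number Y"
proof -
  let ?V = "{..<n}"
  \<comment> \<open>Lists count a cycle once per starting point and direction; overcounting is
    harmless for an upper bound.\<close>
  define C where "C = {c. 3 \<le> length c \<and> length c < r \<and> distinct c \<and> set c \<subseteq> ?V}"
  define I where "I = {S. S \<subseteq> ?V \<and> s \<le> card S}"
  define L where "L k = {c. set c \<subseteq> ?V \<and> length c = k}" for k
  have fin_L: "finite (L k)" and card_L: "card (L k) = n ^ k" for k
    using finite_lists_length_eq[of ?V k] card_lists_length_eq[of ?V k] by (auto simp: L_def)
  have C_sub: "C \<subseteq> (\<Union>k\<in>{3..<r}. L k)"
    by (auto simp: C_def L_def)
  have fin_C: "finite C"
    using C_sub fin_L by (auto intro: finite_subset)
  have fin_I: "finite I"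
    by (simp add: I_def)
  have "(\<Sum>c\<in>C. p ^ card (cycle_edges c)) = (\<Sum>c\<in>C. p ^ length c)"
    by (intro sum.cong) (auto simp: C_def card_cycle_edges)
  also have "\<dots> \<le> (\<Sum>c\<in>(\<Union>k\<in>{3..<r}. L k). p ^ length c)"
    using C_sub fin_L p by (intro sum_mono2) auto
  also have "\<dots> = (\<Sum>k=3..<r. \<Sum>c\<in>L k. p ^ length c)"
    using fin_L by (intro sum.UNION_disjoint) (auto simp: L_def)
  also have "\<dots> = (\<Sum>k=3..<r. (real n * p) ^ k)"
  proof (rule sum.cong[OF refl])
    fix k
    have "(\<Sum>c\<in>L k. p ^ length c) = (\<Sum>c\<in>L k. p ^ k)"
      by (intro sum.cong) (auto simp: L_def)
    then show "(\<Sum>c\<in>L k. p ^ length c) = (real n * p) ^ k"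
      by (simp add: card_L power_mult_distrib)
  qed
  finally have C_bound: "(\<Sum>c\<in>C. p ^ card (cycle_edges c)) \<le> (\<Sum>k=3..<r. (real n * p) ^ k)" .
  have "(\<Sum>S\<in>I. (1 - p) ^ card (nsets S 2)) \<le> (\<Sum>S\<in>I. (1 - p) ^ (s choose 2))"
  proof (rule sum_mono)
    fix S assume "S \<in> I"
    then have "s choose 2 \<le> card (nsets S 2)"
      by (simp add: I_def binomial_right_mono)
    then show "(1 - p) ^ card (nsets S 2) \<le> (1 - p) ^ (s choose 2)"
      using p by (intro power_decreasing) auto
  qed
  also have "\<dots> \<le> 2 ^ n * (1 - p) ^ (s choose 2)"
  proof -
    have "card I \<le> card (Pow ?V)"
      by (intro card_mono) (auto simp: I_def)
    then have "real (card I) \<le> 2 ^ n"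
      by (simp add: card_Pow)
    then show ?thesis
      using p by (simp add: mult_right_mono)
  qed
  finally have I_bound: "real n / 2 * (\<Sum>S\<in>I. (1 - p) ^ card (nsets S 2))
      \<le> real n / 2 * (2 ^ n * (1 - p) ^ (s choose 2))"
    by (intro mult_left_mono) auto
  obtain E where E: "E \<subseteq> nsets ?V 2"
    and few: "real (card {c \<in> C. cycle_edges c \<subseteq> E}) < real n / 2"
    and hit: "\<And>S. S \<in> I \<Longrightarrow> nsets S 2 \<inter> E \<noteq> {}"
  proof (rule exists_random_subset[of "nsets ?V 2" C I cycle_edges "\<lambda>S. nsets S 2" p "real n / 2"])
    show "finite (nsets ?V 2)" by (simp add: finite_imp_finite_nsets)
    show "cycle_edges c \<subseteq> nsets ?V 2" if "c \<in> C" for c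
      using that by (intro cycle_edges_subset) (auto simp: C_def)
    show "nsets S 2 \<subseteq> nsets ?V 2" if "S \<in> I" for S
      using that by (intro nsets_mono) (auto simp: I_def)
    show "(\<Sum>c\<in>C. p ^ card (cycle_edges c)) + real n / 2 * (\<Sum>S\<in>I. (1 - p) ^ card (nsets S 2))
      < real n / 2"
      using bound C_bound I_bound by linarith
  qed (use fin_C fin_I p in auto)
  \<comment> \<open>One vertex of each short cycle is removed, so a short cycle surviving in
    \<open>Y\<close> would have its own head in \<open>X\<close>.\<close>
  define X where "X = hd ` {c \<in> C. cycle_edges c \<subseteq> E}"
  define Y where "Y = (?V - X, {e \<in> E. e \<subseteq> ?V - X})"
  have Y: "fin_simple_graph Y"
    using E by (auto simp: fin_simple_graph_def Y_def nsets_def)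
  then have sub: "is_subgraph Y (complete_graph n)"
    using E by (auto simp: is_subgraph_def complete_graph_def Y_def)
  have "enat r \<le> girth Y"
    unfolding girth_def
  proof (rule INF_greatest)
    fix c assume "c \<in> {c. is_cycle Y c}"
    then have c: "3 \<le> length c" "distinct c" "set c \<subseteq> ?V - X" "cycle_edges c \<subseteq> E"
      by (auto simp: is_cycle_iff_cycle_edges Y_def)
    show "enat r \<le> enat (length c)"
    proof (rule ccontr)
      assume "\<not> enat r \<le> enat (length c)"
      with c have "hd c \<in> X"
        by (auto simp: X_def C_def)
      moreover have "hd c \<in> set c"
        using c(1) by (intro hd_in_set) auto
      ultimately show False using c(3) by blast
    qed
  qed
  moreover have "real n / 2 / real s \<le> fractional_chromatic_number Y"
  proof -
    have "card X \<le> card {c \<in> C. cycle_edges c \<subseteq> E}"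
      unfolding X_def using fin_C by (intro card_image_le) auto
    moreover have "card ?V - card X \<le> card (?V - X)"
      using fin_C by (intro diff_card_le_card_Diff) (auto simp: X_def)
    ultimately have "real n / 2 \<le> real (card (vertices Y))"
      using few by (simp add: Y_def)
    then have "real n / 2 / real s \<le> real (card (vertices Y)) / real s"
      by (intro divide_right_mono) auto
    also have "\<dots> \<le> fractional_chromatic_number Y"
    proof (rule fractional_chromatic_number_ge[OF Y])
      fix S assume S: "S \<in> independent_sets Y"
      show "real (card S) \<le> real s"
      proof (rule ccontr)
        assume "\<not> real (card S) \<le> real s"
        with S have "S \<in> I"
          by (auto simp: independent_sets_def I_def Y_def)
        \<comment> \<open>\<open>S\<close> avoids \<open>X\<close>, so an edge of \<open>E\<close>
          inside \<open>S\<close> survives the deletion and contradicts independence in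
          \<open>Y\<close>.\<close>
        then obtain e where "e \<in> nsets S 2" "e \<in> E"
          using hit by blast
        with S show False
          by (auto simp: independent_sets_def Y_def nsets_def)
      qed
    qed (use s in simp)
    finally show ?thesis .
  qed
  ultimately show ?thesis using sub that by blast
qed

section \<open>Asymptotic choice of the parameters\<close>

lemma eventually_high_girth_graph:
  fixes r :: nat and \<delta> :: real
  assumes "4 \<le> r" and "0 < \<delta>" and \<delta>: "\<delta> < 1 / (2 * (real r - 1))"
  shows "\<forall>\<^sub>F n in sequentially. \<exists>Y. is_subgraph Y (complete_graph n) \<and> enat r \<le> girth Y \<and>
    1 / 10 * (real n powr \<delta> / ln (real n)) \<le> fractional_chromatic_number Y"
proof -
  \<comment> \<open>The exponent of n in \<open>(n * p) ^ (r - 1)\<close>; the upper bound on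
    \<delta> says exactly that it is below 1.\<close>
  define \<epsilon> where "\<epsilon> = 2 * \<delta> * (real r - 1)"
  have \<epsilon>: "\<epsilon> < 1"
    using assms by (simp add: \<epsilon>_def field_simps)
  \<comment> \<open>Since \<open>r - 1\<close> is at least 3, \<delta> is below 1/6, which gives
    \<open>p \<le> 1\<close> and a positive exponent \<open>1 - \<delta>\<close>.\<close>
  have "2 * \<delta> * 3 \<le> \<epsilon>"
    unfolding \<epsilon>_def using assms(1,2) by (intro mult_left_mono) auto
  with \<epsilon> have \<delta>': "\<delta> < 1 / 6" by simp
  have "\<forall>\<^sub>F n in sequentially. real r * real n powr \<epsilon> < real n / 4"
    using \<epsilon> by real_asymp
  moreover have "\<forall>\<^sub>F n in sequentially. 1 < real n powr (1 - \<delta>)"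
    using \<delta>' by real_asymp
  moreover have "\<forall>\<^sub>F n in sequentially. 2 ^ n * exp (- 2 * real n) < (1 / 2 :: real)"
    by real_asymp
  moreover have "\<forall>\<^sub>F n in sequentially. 1 \<le> ln (real n)"
    by real_asymp
  moreover have "\<forall>\<^sub>F n in sequentially. 2 \<le> n"
    by (rule eventually_ge_at_top)
  ultimately show ?thesis
  proof eventually_elim
    case (elim n)
    define p where "p = real n powr (2 * \<delta> - 1)"
    define s where "s = nat \<lceil>4 * real n powr (1 - \<delta>)\<rceil>"
    \<comment> \<open>Rounding up costs less than 1, which is absorbed by a fifth copy of
      \<open>n powr (1 - \<delta>)\<close>.\<close>
    have s_lower: "4 * real n powr (1 - \<delta>) \<le> real s" and s_upper: "real s \<le> 5 * real n powr (1 - \<delta>)"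
      using elim(2) unfolding s_def by linarith+
    have s4: "4 \<le> real s" using s_lower elim(2) by simp
    have p: "0 \<le> p" "p \<le> 1"
      using elim(5) \<delta>' powr_mono[of "2 * \<delta> - 1" 0 "real n"] by (auto simp: p_def)
    have np: "real n * p = real n powr (2 * \<delta>)"
      using elim(5) by (simp add: p_def powr_mult_base)
    have np_ge: "1 \<le> real n * p"
      unfolding np using elim(5) assms(2) by (intro ge_one_powr_ge_zero) auto
    \<comment> \<open>As \<open>n * p\<close> is at least 1, the highest exponent dominates each of
      the fewer than \<open>r\<close> terms.\<close>
    have "(\<Sum>k=3..<r. (real n * p) ^ k) \<le> (\<Sum>k=3..<r. (real n * p) ^ (r - 1))"
      using np_ge by (intro sum_mono power_increasing) auto
    also have "\<dots> \<le> real r * (real n * p) ^ (r - 1)"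
      using np_ge by (simp add: mult_right_mono)
    also have "(real n * p) ^ (r - 1) = real n powr \<epsilon>"
      using elim(5) assms(1) by (simp add: np powr_powr \<epsilon>_def of_nat_diff flip: powr_realpow)
    finally have cycles: "(\<Sum>k=3..<r. (real n * p) ^ k) < real n / 4"
      using elim(1) by linarith
    have choose: "real s ^ 2 / 4 \<le> real (s choose 2)"
    proof -
      have "real (s choose 2) = real s * (real s - 1) / 2"
        using s4 by (simp add: choose_two real_of_nat_div of_nat_diff)
      moreover have "real s * (real s / 2) \<le> real s * (real s - 1)"
        using s4 by (intro mult_left_mono) auto
      ultimately show ?thesis by (simp add: power2_eq_square)
    qed
    \<comment> \<open>The powers of n multiply to n, so the right-hand side is 4n; the factor 4 in
      \<open>s\<close> makes it large enough for \<open>exp (- 2 * n)\<close> to beat the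
      \<open>2 ^ n\<close> of the union bound.\<close>
    have "2 * real n \<le> p * ((4 * real n powr (1 - \<delta>)) ^ 2 / 4)"
    proof -
      have "p * (real n powr (1 - \<delta>)) ^ 2 = real n powr ((2 * \<delta> - 1) + (1 - \<delta>) * 2)"
        using elim(5) by (simp add: p_def powr_powr flip: powr_add powr_realpow)
      also have "(2 * \<delta> - 1) + (1 - \<delta>) * 2 = 1" by simp
      finally show ?thesis
        using elim(5) by (simp add: power_mult_distrib)
    qed
    also have "\<dots> \<le> p * (real s ^ 2 / 4)"
      using s_lower p by (intro mult_left_mono divide_right_mono power_mono) auto
    also have "\<dots> \<le> p * real (s choose 2)"
      using choose p by (intro mult_left_mono) auto
    finally have exponent: "2 * real n \<le> p * real (s choose 2)" .
    have "(1 - p) ^ (s choose 2) \<le> exp (- p) ^ (s choose 2)"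
      using p exp_ge_add_one_self[of "- p"] by (intro power_mono) auto
    also have "\<dots> = exp (- (p * real (s choose 2)))"
      by (simp add: mult.commute flip: exp_of_nat_mult)
    also have "\<dots> \<le> exp (- 2 * real n)"
      using exponent by simp
    finally have "2 ^ n * (1 - p) ^ (s choose 2) \<le> 2 ^ n * exp (- 2 * real n)"
      by simp
    with elim(3) have "2 ^ n * (1 - p) ^ (s choose 2) \<le> 1 / 2"
      by linarith
    then have "real n / 2 * (2 ^ n * (1 - p) ^ (s choose 2)) \<le> real n / 2 * (1 / 2)"
      by (rule mult_left_mono) simp
    \<comment> \<open>The cycles use strictly less than n/4 and the independent sets at most
      n/4.\<close>
    with cycles have bound: "(\<Sum>k=3..<r. (real n * p) ^ k)
        + real n / 2 * (2 ^ n * (1 - p) ^ (s choose 2)) < real n / 2"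
      by linarith
    obtain Y where Y: "is_subgraph Y (complete_graph n)" "enat r \<le> girth Y"
      "real n / 2 / real s \<le> fractional_chromatic_number Y"
      using exists_high_girth_graph[OF p _ bound] s4 by auto
    \<comment> \<open>The constant 1/10 is the 1/2 of the remaining vertices over the 5 of
      \<open>s_upper\<close>; dividing by \<open>ln n \<ge> 1\<close> only lowers the bound.\<close>
    have "1 / 10 * (real n powr \<delta> / ln (real n)) \<le> 1 / 10 * real n powr \<delta>"
      using elim(4) mult_right_mono[of 1 "ln (real n)" "real n powr \<delta>"] by (simp add: field_simps)
    also have "\<dots> = real n / 2 / (5 * real n powr (1 - \<delta>))"
      using elim(5) by (simp add: powr_diff)
    also have "\<dots> \<le> real n / 2 / real s"
      using s_upper s4 elim(5) by (intro divide_left_mono mult_pos_pos) auto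
    finally show ?case using Y by fastforce
  qed
qed

theorem proposition9p14:
  fixes r :: nat and \<delta> :: real
  assumes "4 \<le> r" and "0 < \<delta>" and "\<delta> < 1 / (2 * (real r - 1))"
  shows "\<exists>c>0.
    (\<forall>\<^sub>F n in sequentially. \<exists>Y F. is_subgraph Y (complete_graph n) \<and> F \<subseteq> edges Y \<and>
        c * (real n powr \<delta> / ln (real n)) \<le> fractional_chromatic_number Y \<and>
        max_degree (vertices Y, F) \<le> 1 \<and>
        enat r \<le> girth (delete_edges Y F)) \<and>
    (\<exists>c'>0. c' \<le> c \<and>
      (\<forall>\<^sub>F n in sequentially.
        c' * (real n powr \<delta> / ln (real n)) \<le> h_frac r (complete_graph n)))"
\<comment> \<open>The same \<open>Y\<close> serves both claims: with \<open>F = {}\<close>, and as a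
  competitor in the maximum defining \<open>h_frac\<close>. Hence both constants can be
  equal.\<close>
proof (rule exI[of _ "1 / 10"], intro conjI exI[of _ "1 / 10"])
  note ev = eventually_high_girth_graph[OF assms]
  show "\<forall>\<^sub>F n in sequentially. \<exists>Y F. is_subgraph Y (complete_graph n) \<and> F \<subseteq> edges Y \<and>
      1 / 10 * (real n powr \<delta> / ln (real n)) \<le> fractional_chromatic_number Y \<and>
      max_degree (vertices Y, F) \<le> 1 \<and> enat r \<le> girth (delete_edges Y F)"
    using ev
  proof eventually_elim
    case (elim n)
    then obtain Y where Y: "is_subgraph Y (complete_graph n)" "enat r \<le> girth Y"
      "1 / 10 * (real n powr \<delta> / ln (real n)) \<le> fractional_chromatic_number Y"
      by blast
    have "max_degree (vertices Y, {}) \<le> 1"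
      using Y(1) by (simp add: max_degree_def degree_def is_subgraph_def fin_simple_graph_def)
    moreover have "delete_edges Y {} = Y"
      by (simp add: delete_edges_def)
    ultimately show ?case
      using Y by (intro exI[of _ Y] exI[of _ "{}"]) simp
  qed
  show "\<forall>\<^sub>F n in sequentially.
      1 / 10 * (real n powr \<delta> / ln (real n)) \<le> h_frac r (complete_graph n)"
    using ev
  proof eventually_elim
    case (elim n)
    then obtain Y where Y: "is_subgraph Y (complete_graph n)" "enat r \<le> girth Y"
      "1 / 10 * (real n powr \<delta> / ln (real n)) \<le> fractional_chromatic_number Y"
      by blast
    \<comment> \<open>Finiteness is what makes \<open>Max\<close> an upper bound for its
      elements.\<close>
    have "finite {H. is_subgraph H (complete_graph n)}"
      by (rule finite_subgraphs) (simp add: fin_simple_graph_def complete_graph_def)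
    then have "finite {fractional_chromatic_number H |H.
        is_subgraph H (complete_graph n) \<and> enat r \<le> girth H}"
      by (rule finite_subset[OF _ finite_imageI, rotated]) auto
    with Y(1,2) have "fractional_chromatic_number Y \<le> h_frac r (complete_graph n)"
      unfolding h_frac_def by (intro Max_ge) blast+
    with Y(3) show ?case by linarith
  qed
qed auto

end
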